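(* Let $d$ be a square-free rational integer with $d\equiv 1\pmod 4$ and $d\neq 1$, let $K=\mathbb{Q}(\sqrt{d})$ be the corresponding quadratic field with ring of algebraic integers $O_{K}=\mathbb{Z}\left[\frac{1+\sqrt{d}}{2}\right]$, and let $\sigma,\tau$ be two different non-zero ring endomorphisms of $O_{K}$. Let $D:O_{K}\to O_{K}$ be a $(\sigma,\tau)$-derivation with $D\left(\frac{1+\sqrt{d}}{2}\right)=c_{0}+c_{1}\left(\frac{1+\sqrt{d}}{2}\right)$, where $c_{0},c_{1}\in\mathbb{Z}$. Then $D$ is inner if and only if $d$ divides both $-c_{0}+c_{1}\left(\frac{d-1}{2}\right)$ and $2c_{0}+c_{1}$. In particular: (i) $D$ is inner if $d$ divides both $c_{0}$ and $c_{1}$; (ii) $O_{K}$ has non-trivial outer $(\sigma,\tau)$-derivations, that is, $\mathrm{Out}_{(\sigma,\tau)}(O_{K})\neq\{0\}$.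
   Context: $O_{K}$ is regarded as a commutative unital $\mathbb{Z}$-algebra. A $(\sigma,\tau)$-derivation of $O_{K}$ is a $\mathbb{Z}$-linear map $D:O_{K}\to O_{K}$ with $D(xy)=D(x)\tau(y)+\sigma(x)D(y)$ for all $x,y\in O_{K}$. It is called inner if there exists $\beta\in O_{K}$ with $D(x)=\beta\tau(x)-\sigma(x)\beta$ for all $x\in O_{K}$. $\mathrm{Out}_{(\sigma,\tau)}(O_{K})$ denotes the quotient of the $\mathbb{Z}$-module $\mathcal{D}_{(\sigma,\tau)}(O_{K})$ of all $(\sigma,\tau)$-derivations by the submodule $\mathrm{Inn}_{(\sigma,\tau)}(O_{K})$ of inner ones. *)

theory Defs
  imports
    "HOL-Algebra.Algebra"
    "HOL-Algebra.Algebraic_Closure_Type"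
    "HOL-Number_Theory.Cong"
begin

text \<open>
  Maps out of the carrier of a HOL-Algebra structure are total functions on the underlying type.
  All notions below only depend on their restrictions to the carrier; in the module of all
  $(\sigma,\tau)$-derivations every map is represented by its extensional representative, so that
  equality there is equality of maps on the carrier.
\<close>

text \<open>
  Unlike \<^term>\<open>ring_hom R R\<close>, preservation of \<open>1\<close> is not required here; this is
  what makes ``non-zero'' a meaningful condition.
\<close>

definition ring_endomorphism :: "('a, 'm) ring_scheme \<Rightarrow> ('a \<Rightarrow> 'a) \<Rightarrow> bool" where
  "ring_endomorphism A f \<longleftrightarrow>
     f \<in> carrier A \<rightarrow> carrier A \<and>
     (\<forall>x\<in>carrier A. \<forall>y\<in>carrier A.
        f (x \<oplus>\<^bsub>A\<^esub> y) = f x \<oplus>\<^bsub>A\<^esub> f y \<and> f (x \<otimes>\<^bsub>A\<^esub> y) = f x \<otimes>\<^bsub>A\<^esub> f y)"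

definition twisted_derivation ::
  "('r, 'n) ring_scheme \<Rightarrow> ('r, 'a, 'm) module_scheme \<Rightarrow> ('a \<Rightarrow> 'a) \<Rightarrow> ('a \<Rightarrow> 'a) \<Rightarrow> ('a \<Rightarrow> 'a) \<Rightarrow> bool"
  where
  "twisted_derivation R A \<sigma> \<tau> D \<longleftrightarrow>
     D \<in> carrier A \<rightarrow> carrier A \<and>
     (\<forall>x\<in>carrier A. \<forall>y\<in>carrier A. D (x \<oplus>\<^bsub>A\<^esub> y) = D x \<oplus>\<^bsub>A\<^esub> D y) \<and>
     (\<forall>r\<in>carrier R. \<forall>x\<in>carrier A. D (r \<odot>\<^bsub>A\<^esub> x) = r \<odot>\<^bsub>A\<^esub> D x) \<and>
     (\<forall>x\<in>carrier A. \<forall>y\<in>carrier A.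
        D (x \<otimes>\<^bsub>A\<^esub> y) = (D x \<otimes>\<^bsub>A\<^esub> \<tau> y) \<oplus>\<^bsub>A\<^esub> (\<sigma> x \<otimes>\<^bsub>A\<^esub> D y))"

definition is_inner :: "('a, 'm) ring_scheme \<Rightarrow> ('a \<Rightarrow> 'a) \<Rightarrow> ('a \<Rightarrow> 'a) \<Rightarrow> ('a \<Rightarrow> 'a) \<Rightarrow> bool"
  where
  "is_inner A \<sigma> \<tau> D \<longleftrightarrow>
     (\<exists>\<beta>\<in>carrier A. \<forall>x\<in>carrier A. D x = (\<beta> \<otimes>\<^bsub>A\<^esub> \<tau> x) \<ominus>\<^bsub>A\<^esub> (\<sigma> x \<otimes>\<^bsub>A\<^esub> \<beta>))"

text \<open>
  HOL-Algebra modules are records extending rings, but the locale \<^locale>\<open>module\<close> does not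
  constrain the fields \<open>mult\<close> and \<open>one\<close>; they are left \<^term>\<open>undefined\<close>
  for structures that are only modules.
\<close>

definition derivation_module ::
  "('r, 'n) ring_scheme \<Rightarrow> ('r, 'a, 'm) module_scheme \<Rightarrow> ('a \<Rightarrow> 'a) \<Rightarrow> ('a \<Rightarrow> 'a) \<Rightarrow> ('r, 'a \<Rightarrow> 'a) module"
  where
  "derivation_module R A \<sigma> \<tau> =
     \<lparr>carrier = {D \<in> extensional (carrier A). twisted_derivation R A \<sigma> \<tau> D},
      monoid.mult = undefined, monoid.one = undefined,
      ring.zero = (\<lambda>x\<in>carrier A. \<zero>\<^bsub>A\<^esub>),
      ring.add = (\<lambda>D E. \<lambda>x\<in>carrier A. D x \<oplus>\<^bsub>A\<^esub> E x),
      module.smult = (\<lambda>r D. \<lambda>x\<in>carrier A. r \<odot>\<^bsub>A\<^esub> D x)\<rparr>"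

definition inner_derivations ::
  "('r, 'n) ring_scheme \<Rightarrow> ('r, 'a, 'm) module_scheme \<Rightarrow> ('a \<Rightarrow> 'a) \<Rightarrow> ('a \<Rightarrow> 'a) \<Rightarrow> ('a \<Rightarrow> 'a) set"
  where
  "inner_derivations R A \<sigma> \<tau> =
     {D \<in> carrier (derivation_module R A \<sigma> \<tau>). is_inner A \<sigma> \<tau> D}"

text \<open>
  The elements are the cosets of \<open>N\<close>. In the scalar multiplication, \<open>N\<close> is added
  because \<open>r \<cdot> (N + x)\<close>, taken elementwise, may be strictly smaller than the coset
  \<open>N + r \<cdot> x\<close>.
\<close>

definition quotient_module :: "('r, 'a, 'm) module_scheme \<Rightarrow> 'a set \<Rightarrow> ('r, 'a set) module" where
  "quotient_module M N =
     \<lparr>carrier = a_rcosets\<^bsub>M\<^esub> N,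
      monoid.mult = undefined, monoid.one = undefined,
      ring.zero = N,
      ring.add = (\<lambda>U V. U <+>\<^bsub>M\<^esub> V),
      module.smult = (\<lambda>r U. N <+>\<^bsub>M\<^esub> ((\<lambda>x. r \<odot>\<^bsub>M\<^esub> x) ` U))\<rparr>"

definition outer_derivations ::
  "('r, 'n) ring_scheme \<Rightarrow> ('r, 'a, 'm) module_scheme \<Rightarrow> ('a \<Rightarrow> 'a) \<Rightarrow> ('a \<Rightarrow> 'a) \<Rightarrow> ('r, ('a \<Rightarrow> 'a) set) module"
  where
  "outer_derivations R A \<sigma> \<tau> =
     quotient_module (derivation_module R A \<sigma> \<tau>) (inner_derivations R A \<sigma> \<tau>)"

text \<open>
  \<open>\<rat>(\<surd>d)\<close> as the subfield of the complex numbers generated by \<open>\<surd>d\<close>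
  (the principal root; for negative \<open>d\<close> it is \<open>\<i> * \<surd>\<bar>d\<bar>\<close>).
\<close>

definition quadratic_field :: "int \<Rightarrow> complex set" where
  "quadratic_field d = generate_field ring_of_type_algebra {csqrt (of_int d)}"

definition quadratic_integers :: "int \<Rightarrow> (int, complex) module" where
  "quadratic_integers d =
     \<lparr>carrier = {x \<in> quadratic_field d. algebraic_int x},
      monoid.mult = (*), monoid.one = 1, ring.zero = 0, ring.add = (+),
      module.smult = (\<lambda>k x. of_int k * x)\<rparr>"

end

(*
  Gauss's lemma makes the quadratic polynomial of an irrational algebraic integer of Q(sqrt d)
  monic over Z, which gives O_K = Z + Z w with w = (1 + sqrt d) / 2.  A non-zero ring endomorphism
  of O_K fixes Z and sends w to w or 1 - w, so for sigma different from tau the difference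
  tau - sigma is a + b w |-> b sqrt d up to sign.  As a derivation is determined by its value at w,
  it is inner iff sqrt d divides that value in O_K; this unfolds to the two divisibility conditions.
  The map (tau - sigma) / sqrt d is a derivation with value 1 or -1 at w, so it is not inner.
*)
theory Submission
  imports Defs
begin

section \<open>Integer polynomials evaluated at algebraic integers, and Gauss's lemma\<close>

lemma poly_of_int_add:
  "poly (map_poly of_int (p + q)) (x :: 'a :: comm_ring_1) =
     poly (map_poly of_int p) x + poly (map_poly of_int q) x"
proof -
  have "map_poly of_int (p + q) = map_poly of_int p + (map_poly of_int q :: 'a poly)"
    by (intro poly_eqI) (simp add: coeff_map_poly)
  then show ?thesis by simp
qed

lemma poly_of_int_smult:
  "poly (map_poly of_int (smult c p)) (x :: 'a :: comm_ring_1) =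
     of_int c * poly (map_poly of_int p) x"
proof -
  have "map_poly of_int (smult c p) = smult (of_int c) (map_poly of_int p :: 'a poly)"
    by (intro poly_eqI) (simp add: coeff_map_poly)
  then show ?thesis by simp
qed

lemma poly_of_int_mult:
  "poly (map_poly of_int (p * q)) (x :: 'a :: comm_ring_1) =
     poly (map_poly of_int p) x * poly (map_poly of_int q) x"
proof (induction p)
  case 0
  then show ?case by simp
next
  case (pCons a p)
  then show ?case
    by (simp add: poly_of_int_add poly_of_int_smult map_poly_pCons algebra_simps)
qed

text \<open>A monic \<open>f\<close> vanishing at \<open>x\<close> satisfies
  \<open>smult a f = g * q\<close> by minimality of \<open>g\<close>. Contents are multiplicative,
  so \<open>q\<close> has content \<open>\<bar>a\<bar>\<close> and \<open>a\<close> divides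
  \<open>lead_coeff q\<close>; comparing leading coefficients then leaves
  \<open>lead_coeff g\<close> a divisor of 1.\<close>

lemma algebraic_int_lead_coeff_unit:
  fixes x :: "'a :: field_char_0" and g :: "int poly"
  assumes x: "algebraic_int x"
    and g: "poly (map_poly of_int g) x = 0" "content g = 1"
    and minimal: "\<And>r :: int poly. degree r < degree g \<Longrightarrow> poly (map_poly of_int r) x = 0 \<Longrightarrow> r = 0"
  shows "is_unit (lead_coeff g)"
proof -
  obtain f :: "int poly" where f: "poly (map_poly of_int f) x = 0" "lead_coeff f = 1"
    using x unfolding algebraic_int_altdef_ipoly by blast
  have "g \<noteq> 0"
    using g(2) by auto
  \<comment> \<open>Pseudo-division stays inside the integer polynomials at the cost of the factor
    \<open>a\<close>. The remainder vanishes at \<open>x\<close> too, hence is zero by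
    minimality.\<close>
  from pseudo_mod[OF this, of f] obtain a q where aq: "a \<noteq> 0"
    "smult a f = g * q + pseudo_mod f g"
    and deg: "pseudo_mod f g = 0 \<or> degree (pseudo_mod f g) < degree g"
    by blast
  have "poly (map_poly of_int (pseudo_mod f g)) x = 0"
    using arg_cong[OF aq(2), of "\<lambda>p. poly (map_poly of_int p) x"] f(1) g(1)
    by (simp add: poly_of_int_add poly_of_int_smult poly_of_int_mult)
  then have eq: "smult a f = g * q"
    using minimal[of "pseudo_mod f g"] deg aq(2) by auto
  have "content f dvd lead_coeff f"
    by (rule content_dvd_coeff)
  then have "content f = 1"
    using f(2) is_unit_content_iff by metis
  then have "content q = \<bar>a\<bar>"
    using arg_cong[OF eq, of content] g(2) by (simp add: content_mult)
  then have "a dvd lead_coeff q"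
    using content_dvd_coeff[of q "degree q"] by simp
  then obtain b where "lead_coeff q = a * b" ..
  moreover have "a = lead_coeff g * lead_coeff q"
    using arg_cong[OF eq, of lead_coeff] f(2) aq(1) by (simp add: lead_coeff_mult)
  ultimately have "a * (lead_coeff g * b) = a * 1"
    by (simp add: algebra_simps)
  then have "1 = lead_coeff g * b"
    using aq(1) mult_cancel_left by metis
  then show ?thesis ..
qed

text \<open>Irrationality of \<open>x\<close> excludes a nonzero integer polynomial of degree at
  most 1 vanishing at \<open>x\<close>, so the primitive part of the given quadratic is minimal and
  its leading coefficient is a unit.\<close>

lemma algebraic_int_quadratic:
  fixes x :: "'a :: field_char_0" and A B C :: int
  assumes x: "algebraic_int x" "x \<notin> \<rat>" and "A \<noteq> 0"
    and root: "of_int A * x\<^sup>2 + of_int B * x + of_int C = 0"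
  obtains t n :: int where "x\<^sup>2 = of_int t * x + of_int n"
proof -
  define G where "G = [:C, B, A:]"
  define g where "g = primitive_part G"
  have G: "G \<noteq> 0" "degree G = 2"
    using \<open>A \<noteq> 0\<close> by (auto simp: G_def)
  have Gg: "G = smult (content G) g"
    by (simp add: g_def)
  have "poly (map_poly of_int G) x = 0"
    using root by (simp add: G_def map_poly_pCons power2_eq_square algebra_simps)
  then have gx: "poly (map_poly of_int g) x = 0"
    using G(1) by (subst (asm) Gg) (simp add: poly_of_int_smult)
  have deg: "degree g = 2"
    using G by (simp add: g_def)
  have "is_unit (lead_coeff g)"
  proof (rule algebraic_int_lead_coeff_unit[OF x(1) gx])
    show "content g = 1"
      using G(1) by (simp add: g_def)
  next
    fix r :: "int poly"
    assume r: "degree r < degree g" "poly (map_poly of_int r) x = 0"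
    obtain u v where uv: "r = [:u, v:]"
    proof
      show "r = [:coeff r 0, coeff r 1:]"
        using r(1) deg by (intro poly_eqI) (auto simp: coeff_pCons coeff_eq_0 split: nat.splits)
    qed
    have *: "of_int u + of_int v * x = 0"
      using r(2) by (simp add: uv map_poly_pCons algebra_simps)
    have "v = 0"
    proof (rule ccontr)
      assume "v \<noteq> 0"
      then have "x = - of_int u / of_int v"
        using * by (simp add: field_simps add_eq_0_iff2)
      also have "\<dots> \<in> \<rat>"
        by simp
      finally show False using x(2) by simp
    qed
    with * uv show "r = 0" by simp
  qed
  \<comment> \<open>A unit of the integers is its own inverse, so multiplying the relation by
    \<open>coeff g 2\<close> makes it monic whatever the sign.\<close>
  then have unit: "coeff g 2 * coeff g 2 = 1"
    using deg by (auto simp: zdvd1_eq abs_if split: if_splits)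
  have eq: "g = [:coeff g 0, coeff g 1, coeff g 2:]"
    using deg by (intro poly_eqI) (auto simp: coeff_pCons coeff_eq_0 numeral_2_eq_2 split: nat.splits)
  have "of_int (coeff g 0) + of_int (coeff g 1) * x + of_int (coeff g 2) * x\<^sup>2 = 0"
    using gx by (subst (asm) eq) (simp add: map_poly_pCons power2_eq_square algebra_simps)
  then have "of_int (coeff g 2) * (of_int (coeff g 0) + of_int (coeff g 1) * x + of_int (coeff g 2) * x\<^sup>2) = 0"
    by simp
  then have "of_int (coeff g 2 * coeff g 2) * x\<^sup>2 =
      of_int (- coeff g 2 * coeff g 1) * x + of_int (- coeff g 2 * coeff g 0)"
    by (simp add: algebra_simps add_eq_0_iff)
  then have "x\<^sup>2 = of_int (- coeff g 2 * coeff g 1) * x + of_int (- coeff g 2 * coeff g 0)"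
    by (simp only: unit of_int_1 mult_1)
  then show thesis
    by (rule that)
qed

lemma rational_combination_zero:
  fixes p q x :: "'a :: field_char_0"
  assumes "p \<in> \<rat>" "q \<in> \<rat>" "x \<notin> \<rat>" "p + q * x = 0"
  shows "p = 0" "q = 0"
proof -
  show "q = 0"
  proof (rule ccontr)
    assume "q \<noteq> 0"
    then have "x = - p / q"
      using assms(4) by (simp add: field_simps add_eq_0_iff2)
    with assms show False by simp
  qed
  with assms show "p = 0" by simp
qed

text \<open>Write \<open>r = u / v\<close> in lowest terms: the square of \<open>v\<close> divides
  \<open>d\<close> times the square of \<open>u\<close> and is coprime to the latter, so it divides
  \<open>d\<close>, which forces \<open>v = 1\<close>.\<close>

lemma squarefree_mult_square_Ints:
  fixes r :: "'a :: field_char_0" and d :: int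
  assumes "squarefree d" "r \<in> \<rat>" "of_int d * r\<^sup>2 \<in> \<int>"
  shows "r \<in> \<int>"
proof -
  obtain u v :: int where uv: "v > 0" "coprime u v" "r = of_int u / of_int v"
    using assms(2) by (rule Rats_cases')
  obtain k where "of_int d * r\<^sup>2 = of_int k"
    using assms(3) by (rule Ints_cases)
  then have "(of_int (d * u\<^sup>2) :: 'a) = of_int (k * v\<^sup>2)"
    using uv by (simp add: field_simps)
  then have "d * u\<^sup>2 = k * v\<^sup>2"
    by (simp only: of_int_eq_iff)
  then have "v\<^sup>2 dvd d * u\<^sup>2"
    by simp
  moreover have "coprime (v\<^sup>2) (u\<^sup>2)"
    using uv(2) by (simp add: coprime_commute)
  ultimately have "v\<^sup>2 dvd d"
    by (simp add: coprime_dvd_mult_left_iff)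
  then have "v = 1"
    using assms(1) uv(1) by (auto dest!: squarefreeD)
  then show ?thesis
    using uv by simp
qed

section \<open>The integral basis \<open>1\<close>, \<open>w\<close> of the ring of integers\<close>

locale quadratic_1_mod_4 =
  fixes d :: int
  assumes squarefree: "squarefree d" and d_cong: "[d = 1] (mod 4)" and d_neq_1: "d \<noteq> 1"
begin

definition s :: complex where "s = csqrt (of_int d)"

definition w :: complex where "w = (1 + s) / 2"

text \<open>Minus the constant term of the minimal polynomial \<open>X * X - X - m\<close> of
  \<open>w\<close>. The division is exact because \<open>d\<close> is 1 modulo 4.\<close>

definition m :: int where "m = (d - 1) div 4"


lemma four_times_m: "4 * m = d - 1" "4 * (of_int m :: complex) = of_int d - 1"
proof -
  show "4 * m = d - 1"
    using d_cong unfolding m_def cong_def by presburger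
  from arg_cong[OF this, of of_int]
  show "4 * (of_int m :: complex) = of_int d - 1"
    by simp
qed

lemma odd_d: "odd d"
  using four_times_m(1) by presburger

lemma d_nonzero: "d \<noteq> 0"
  using squarefree by auto

lemma d_not_unit: "\<not> is_unit d"
proof
  assume "is_unit d"
  then have "d = 1 \<or> d = - 1"
    by (simp add: abs_if split: if_splits)
  \<comment> \<open>The hypotheses exclude \<open>1\<close> directly and \<open>- 1\<close> by the
    congruence.\<close>
  then show False
    using d_neq_1 d_cong by (auto simp: cong_def)
qed

lemma s_squared: "s * s = of_int d"
  unfolding s_def by (metis power2_csqrt power2_eq_square)

text \<open>A rational algebraic integer is an integer, so \<open>d\<close> would be a perfect
  square; being square-free, it would then be a unit.\<close>

lemma s_irrational: "s \<notin> \<rat>"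
proof
  assume "s \<in> \<rat>"
  moreover have "algebraic_int s"
    unfolding s_def by (intro algebraic_int_csqrt int_imp_algebraic_int) auto
  ultimately have "s \<in> \<int>"
    by (simp add: rational_algebraic_int_is_int)
  then obtain k where "s = of_int k"
    by (rule Ints_cases)
  then have "(of_int (k * k) :: complex) = of_int d"
    using s_squared by simp
  then have "k * k = d"
    by (simp only: of_int_eq_iff)
  then have "is_unit d"
    using squarefreeD[OF squarefree, of k] by (metis dvd_refl mult_dvd_mono mult_1 power2_eq_square)
  then show False
    using d_not_unit by simp
qed

lemma s_nonzero: "s \<noteq> 0"
  using s_irrational by auto

lemma s_eq: "s = 2 * w - 1"
  by (simp add: w_def)

lemma w_squared: "w * w = w + of_int m"
proof -
  have "4 * (w * w) = 1 + 2 * s + s * s"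
    by (simp add: w_def algebra_simps)
  also have "\<dots> = 4 * w + 4 * of_int m"
    by (simp add: s_squared four_times_m(2) w_def)
  also have "\<dots> = 4 * (w + of_int m)"
    by (simp only: distrib_left)
  finally show ?thesis
    by (rule mult_left_cancel[THEN iffD1, rotated]) simp
qed

lemma integer_combination_eq_iff:
  "of_int a + of_int b * w = of_int a' + of_int b' * w \<longleftrightarrow> a = a' \<and> b = b'"
proof
  assume "of_int a + of_int b * w = of_int a' + of_int b' * w"
  then have "of_int (a - a') + of_int (b - b') * w = 0"
    by (simp add: algebra_simps)
  moreover have "w \<notin> \<rat>"
  proof
    assume "w \<in> \<rat>"
    then have "2 * w - 1 \<in> \<rat>" by simp
    then show False using s_irrational s_eq by simp
  qed
  ultimately have "(of_int (a - a') :: complex) = 0" "(of_int (b - b') :: complex) = 0"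
    using rational_combination_zero[of "of_int (a - a')" "of_int (b - b')" w] by auto
  then show "a = a' \<and> b = b'"
    by simp
qed simp

text \<open>Induction over the generation of the field: the rational combinations of
  \<open>1\<close> and \<open>s\<close> contain the generator and are closed under the field
  operations.\<close>

lemma quadratic_fieldE:
  assumes "x \<in> quadratic_field d"
  obtains p q where "p \<in> \<rat>" "q \<in> \<rat>" "x = p + q * s"
proof -
  interpret C: field "ring_of_type_algebra :: complex ring"
    by (rule field_from_type_algebra)
  have "\<exists>p\<in>\<rat>. \<exists>q\<in>\<rat>. x = p + q * s"
    using assms unfolding quadratic_field_def
  proof (induction rule: generate_field.induct)
    case one
    then show ?case
      by (intro bexI[of _ 1] bexI[of _ 0]) (auto simp: ring_of_type_algebra_def)
  next
    case (incl h)
    then show ?case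
      by (intro bexI[of _ 0] bexI[of _ 1]) (auto simp: s_def)
  next
    case (a_inv h)
    then obtain p q where pq: "p \<in> \<rat>" "q \<in> \<rat>" "h = p + q * s" by blast
    have "\<ominus>\<^bsub>ring_of_type_algebra\<^esub> h = - h"
      by (rule C.minus_equality) (simp_all add: ring_of_type_algebra_def)
    then show ?case
      using pq by (intro bexI[of _ "- p"] bexI[of _ "- q"]) auto
  next
    case (m_inv h)
    then obtain p q where pq: "p \<in> \<rat>" "q \<in> \<rat>" "h = p + q * s" by blast
    have h: "h \<noteq> 0"
      using m_inv by (simp add: ring_of_type_algebra_def)
    have inv: "inv\<^bsub>ring_of_type_algebra\<^esub> h = inverse h"
      by (rule C.inv_unique'[symmetric]) (use h in \<open>simp_all add: ring_of_type_algebra_def\<close>)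
    \<comment> \<open>\<open>N\<close> is the norm of \<open>h\<close>, a rational number. It is
      nonzero since a vanishing conjugate \<open>p - q * s\<close> would give
      \<open>p = q = 0\<close> and hence \<open>h = 0\<close>; dividing the conjugate by
      \<open>N\<close> yields the inverse.\<close>
    define N where "N = p * p - q * q * of_int d"
    have N: "N = h * (p - q * s)"
      by (simp add: N_def pq algebra_simps flip: s_squared)
    have "p - q * s \<noteq> 0"
      using rational_combination_zero[of p "- q" s] pq s_irrational h by auto
    then have "N \<noteq> 0"
      using N h by simp
    then have "inverse h = (p - q * s) / N"
      unfolding N using h \<open>p - q * s \<noteq> 0\<close> by (simp add: inverse_eq_divide)
    then have "inverse h = p / N + - q / N * s"
      by (simp add: diff_divide_distrib)
    moreover have "p / N \<in> \<rat>" "- q / N \<in> \<rat>"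
      using pq by (auto simp: N_def)
    ultimately show ?case
      unfolding inv by blast
  next
    case (eng_add x y)
    then obtain p q p' q' where pq:
      "p \<in> \<rat>" "q \<in> \<rat>" "x = p + q * s" "p' \<in> \<rat>" "q' \<in> \<rat>" "y = p' + q' * s" by blast
    then have "x + y = (p + p') + (q + q') * s"
      by (simp add: algebra_simps)
    moreover have "p + p' \<in> \<rat>" "q + q' \<in> \<rat>"
      using pq by simp_all
    ultimately show ?case
      by (auto simp: ring_of_type_algebra_def)
  next
    case (eng_mult x y)
    then obtain p q p' q' where pq:
      "p \<in> \<rat>" "q \<in> \<rat>" "x = p + q * s" "p' \<in> \<rat>" "q' \<in> \<rat>" "y = p' + q' * s" by blast
    then have "x * y = (p * p' + q * q' * of_int d) + (p * q' + q * p') * s"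
      by (simp add: algebra_simps flip: s_squared)
    moreover have "p * p' + q * q' * of_int d \<in> \<rat>" "p * q' + q * p' \<in> \<rat>"
      using pq by simp_all
    ultimately show ?case
      by (auto simp: ring_of_type_algebra_def)
  qed
  then show thesis using that by blast
qed

text \<open>For irrational \<open>x = p + q * s\<close> the trace \<open>2 * p\<close> and the norm
  are integers by Gauss's lemma. Square-freeness of \<open>d\<close> then makes \<open>2 * q\<close>
  an integer, and oddness of \<open>d\<close> gives it the parity of the trace.\<close>

lemma algebraic_int_quadratic_fieldE:
  assumes x: "x \<in> quadratic_field d" "algebraic_int x"
  obtains a b where "x = of_int a + of_int b * w"
proof -
  obtain p q where pq: "p \<in> \<rat>" "q \<in> \<rat>" "x = p + q * s"
    using x(1) by (rule quadratic_fieldE)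
  show thesis
  proof (cases "q = 0")
    case True
    then have "x \<in> \<int>"
      using pq x(2) by (simp add: rational_algebraic_int_is_int)
    then obtain a where "x = of_int a"
      by (rule Ints_cases)
    then show thesis
      using that[of a 0] by simp
  next
    case False
    have irrational: "x \<notin> \<rat>"
    proof
      assume "x \<in> \<rat>"
      then have "(x - p) / q \<in> \<rat>" using pq(1,2) by simp
      moreover have "(x - p) / q = s" using pq(3) False by simp
      ultimately show False using s_irrational by simp
    qed
    have eq: "x\<^sup>2 - 2 * p * x + (p\<^sup>2 - of_int d * q\<^sup>2) = 0"
      by (simp add: pq power2_eq_square algebra_simps flip: s_squared)
    have "2 * p \<in> \<rat>"
      using pq by simp
    then obtain u v :: int where "v > 0" "2 * p = of_int u / of_int v"
      by (metis Rats_cases')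
    then have uv: "v \<noteq> 0" "of_int u = of_int v * (2 * p)"
      by simp_all
    have "p\<^sup>2 - of_int d * q\<^sup>2 \<in> \<rat>"
      using pq by simp
    then obtain k l :: int where "l > 0" "p\<^sup>2 - of_int d * q\<^sup>2 = of_int k / of_int l"
      by (metis Rats_cases')
    then have kl: "l \<noteq> 0" "of_int k = of_int l * (p\<^sup>2 - of_int d * q\<^sup>2)"
      by simp_all
    \<comment> \<open>Clearing the denominators \<open>v\<close> of the trace and \<open>l\<close>
      of the norm gives an integer quadratic relation for \<open>x\<close>.\<close>
    have "of_int (v * l) * x\<^sup>2 + of_int (- (u * l)) * x + of_int (k * v) =
        of_int (v * l) * (x\<^sup>2 - 2 * p * x + (p\<^sup>2 - of_int d * q\<^sup>2))"
      by (simp add: uv(2) kl(2) algebra_simps)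
    also have "\<dots> = 0"
      using eq by simp
    finally have root: "of_int (v * l) * x\<^sup>2 + of_int (- (u * l)) * x + of_int (k * v) = 0" .
    have "v * l \<noteq> 0"
      using uv kl by simp
    from algebraic_int_quadratic[OF x(2) irrational this root]
    obtain t n :: int where tn: "x\<^sup>2 = of_int t * x + of_int n"
      by blast
    \<comment> \<open>Subtracting two monic quadratic relations for \<open>x\<close> leaves a linear
      one with rational coefficients. These vanish since \<open>x\<close> is irrational, which
      identifies \<open>t\<close> with the trace and \<open>- n\<close> with the norm.\<close>
    then have "(of_int n + (p\<^sup>2 - of_int d * q\<^sup>2)) + (of_int t - 2 * p) * x = 0"
      using eq by (simp add: algebra_simps)
    then have "of_int n + (p\<^sup>2 - of_int d * q\<^sup>2) = 0" "of_int t - 2 * p = 0"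
      using rational_combination_zero[of "of_int n + (p\<^sup>2 - of_int d * q\<^sup>2)" "of_int t - 2 * p" x]
        pq irrational by auto
    then have p: "2 * p = of_int t" and n: "of_int d * q\<^sup>2 = p\<^sup>2 + of_int n"
      by (simp_all add: algebra_simps)
    have "of_int d * (2 * q)\<^sup>2 = 4 * (of_int d * q\<^sup>2)"
      by (simp add: power_mult_distrib)
    also have "\<dots> = (2 * p)\<^sup>2 + 4 * of_int n"
      by (simp add: n power_mult_distrib)
    finally have n: "of_int d * (2 * q)\<^sup>2 = of_int (t\<^sup>2 + 4 * n)"
      by (simp add: p)
    have "of_int d * (2 * q)\<^sup>2 \<in> \<int>"
      unfolding n by simp
    then have "2 * q \<in> \<int>"
      using squarefree_mult_square_Ints[OF squarefree, of "2 * q"] pq by simp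
    then obtain e where e: "2 * q = of_int e"
      by (rule Ints_cases)
    then have "(of_int (d * e\<^sup>2) :: complex) = of_int (t\<^sup>2 + 4 * n)"
      using n by simp
    then have "d * e\<^sup>2 = t\<^sup>2 + 4 * n"
      by (simp only: of_int_eq_iff)
    then have "even (d * e\<^sup>2) \<longleftrightarrow> even (t\<^sup>2)"
      by simp
    then have "even (t - e)"
      by (simp add: odd_d)
    then obtain a where a: "t - e = 2 * a" ..
    then have t: "t = 2 * a + e"
      by simp
    have "2 * x = 2 * p + 2 * q * s"
      by (simp add: pq algebra_simps)
    also have "\<dots> = 2 * (of_int a + of_int e * w)"
      unfolding p e by (simp add: t w_def algebra_simps)
    finally have "x = of_int a + of_int e * w"
      by (rule mult_left_cancel[THEN iffD1, rotated]) simp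
    then show thesis
      by (rule that)
  qed
qed

lemma integer_combination_in_quadratic_field: "of_int a + of_int b * w \<in> quadratic_field d"
proof -
  interpret C: field "ring_of_type_algebra :: complex ring"
    by (rule field_from_type_algebra)
  let ?F = "quadratic_field d"
  have one: "1 \<in> ?F" and s: "s \<in> ?F"
    unfolding quadratic_field_def s_def
    using generate_field.one[of "ring_of_type_algebra :: complex ring"]
    by (auto simp: ring_of_type_algebra_def intro: generate_field.incl)
  have add: "x + y \<in> ?F" and mult: "x * y \<in> ?F" if "x \<in> ?F" "y \<in> ?F" for x y
    using generate_field.eng_add[of x "ring_of_type_algebra" _ y]
      generate_field.eng_mult[of x "ring_of_type_algebra" _ y] that
    unfolding quadratic_field_def by (auto simp: ring_of_type_algebra_def)
  have minus: "- x \<in> ?F" if "x \<in> ?F" for x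
  proof -
    have "\<ominus>\<^bsub>ring_of_type_algebra\<^esub> x = - x"
      by (rule C.minus_equality) (simp_all add: ring_of_type_algebra_def)
    then show ?thesis
      using generate_field.a_inv[of x "ring_of_type_algebra"] that
      unfolding quadratic_field_def by metis
  qed
  have inverse: "inverse x \<in> ?F" if "x \<in> ?F" "x \<noteq> 0" for x
  proof -
    have "inv\<^bsub>ring_of_type_algebra\<^esub> x = inverse x"
      by (rule C.inv_unique'[symmetric]) (use that in \<open>simp_all add: ring_of_type_algebra_def\<close>)
    then show ?thesis
      using generate_field.m_inv[of x "ring_of_type_algebra"] that
      unfolding quadratic_field_def by (simp add: ring_of_type_algebra_def)
  qed
  have int: "of_int k \<in> ?F" for k
  proof (induction k rule: int_induct[of _ 0])
    case base
    show ?case using add[OF one minus[OF one]] by simp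
  next
    case (step1 i)
    then show ?case using add[OF _ one] by simp
  next
    case (step2 i)
    then show ?case using add[OF _ minus[OF one]] by fastforce
  qed
  have "w = inverse (of_int 2) * (of_int 1 + s)"
    by (simp add: w_def)
  then have "w \<in> ?F"
    using mult inverse int add s by (metis of_int_eq_0_iff zero_neq_numeral)
  then show ?thesis
    using add mult int by blast
qed

lemma algebraic_int_integer_combination: "algebraic_int (of_int a + of_int b * w)"
proof (rule algebraic_int.intros)
  \<comment> \<open>The coefficients come from the trace \<open>2 * a + b\<close> and the norm
    \<open>a * a + a * b - m * b * b\<close>, the conjugate of \<open>w\<close> being
    \<open>1 - w\<close>.\<close>
  let ?p = "[:of_int (a * a + a * b - m * b * b), of_int (- 2 * a - b), 1:] :: complex poly"
  show "lead_coeff ?p = 1" by simp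
  show "\<forall>i. coeff ?p i \<in> \<int>"
    by (auto simp: coeff_pCons split: nat.splits)
  have "poly ?p (of_int a + of_int b * w) = of_int b * of_int b * (w * w - w - of_int m)"
    by (simp add: algebra_simps)
  also have "\<dots> = 0"
    by (simp add: w_squared)
  finally show "poly ?p (of_int a + of_int b * w) = 0" .
qed

lemma carrier_quadratic_integers:
  "carrier (quadratic_integers d) = {of_int a + of_int b * w | a b. True}"
proof (intro equalityI subsetI)
  fix x assume "x \<in> carrier (quadratic_integers d)"
  then show "x \<in> {of_int a + of_int b * w | a b. True}"
    by (auto simp: quadratic_integers_def) (metis algebraic_int_quadratic_fieldE)
next
  fix x assume "x \<in> {of_int a + of_int b * w | a b. True}"
  then show "x \<in> carrier (quadratic_integers d)"
    using integer_combination_in_quadratic_field algebraic_int_integer_combination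
    by (auto simp: quadratic_integers_def)
qed

end

text \<open>One \<open>z\<close> in \<open>N\<close> neutral for \<open>x\<close> places
  \<open>x\<close> in its own coset, which must be \<open>N\<close>. As \<open>M\<close> is a bare
  structure, this applies to derivations without first showing that they form a module.\<close>

lemma a_rcosets_trivial_imp_mem:
  fixes M (structure)
  assumes "a_rcosets N = {N}" "x \<in> carrier M" "z \<in> N" "z \<oplus> x = x"
  shows "x \<in> N"
proof -
  have "N +> x \<in> a_rcosets N"
    using assms(2) by (auto simp: A_RCOSETS_def')
  then have "N +> x = N"
    using assms(1) by simp
  moreover have "x \<in> N +> x"
    using assms(3,4) by (force simp: a_r_coset_def')
  ultimately show ?thesis by simp
qed

text \<open>Both systems involve the matrix with rows \<open>(- 1, 2 * m)\<close> and
  \<open>(2, 1)\<close>, whose square is \<open>d\<close> times the identity. Applying it to the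
  first system gives the second; applying it once more and cancelling \<open>d\<close> leads
  back.\<close>

lemma integer_system_iff:
  fixes d m a b c0 c1 :: int
  assumes d: "d = 4 * m + 1" and "d \<noteq> 0"
  shows "c0 = 2 * m * b - a \<and> c1 = 2 * a + b \<longleftrightarrow>
    - c0 + c1 * (2 * m) = d * a \<and> 2 * c0 + c1 = d * b"
proof (intro iffI conjI)
  assume *: "c0 = 2 * m * b - a \<and> c1 = 2 * a + b"
  show "- c0 + c1 * (2 * m) = d * a" "2 * c0 + c1 = d * b"
    by (simp_all add: * d algebra_simps)
next
  assume *: "- c0 + c1 * (2 * m) = d * a \<and> 2 * c0 + c1 = d * b"
  have "d * c0 = 2 * m * (2 * c0 + c1) - (- c0 + c1 * (2 * m))"
    "d * c1 = 2 * (- c0 + c1 * (2 * m)) + (2 * c0 + c1)"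
    by (simp_all add: d algebra_simps)
  then have "d * c0 = d * (2 * m * b - a)" "d * c1 = d * (2 * a + b)"
    unfolding *[THEN conjunct1] *[THEN conjunct2] by (simp_all add: algebra_simps)
  then show "c0 = 2 * m * b - a" "c1 = 2 * a + b"
    using \<open>d \<noteq> 0\<close> by simp_all
qed

section \<open>Endomorphisms and twisted derivations of the ring of integers\<close>

context quadratic_1_mod_4
begin

abbreviation A :: "(int, complex) module" where "A \<equiv> quadratic_integers d"

lemma mem_carrier: "of_int a + of_int b * w \<in> carrier A"
  by (auto simp: carrier_quadratic_integers)

lemma carrierE:
  assumes "x \<in> carrier A"
  obtains a b where "x = of_int a + of_int b * w"
  using assms by (auto simp: carrier_quadratic_integers)

lemma operations [simp]:
  "x \<oplus>\<^bsub>A\<^esub> y = x + y" "x \<otimes>\<^bsub>A\<^esub> y = x * y" "\<zero>\<^bsub>A\<^esub> = 0" "k \<odot>\<^bsub>A\<^esub> x = of_int k * x"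
  by (simp_all add: quadratic_integers_def)

lemma carrier_add:
  assumes "x \<in> carrier A" "y \<in> carrier A"
  shows "x + y \<in> carrier A"
proof -
  obtain a b where x: "x = of_int a + of_int b * w"
    using assms(1) by (rule carrierE)
  obtain a' b' where y: "y = of_int a' + of_int b' * w"
    using assms(2) by (rule carrierE)
  have "x + y = of_int (a + a') + of_int (b + b') * w"
    by (simp add: x y algebra_simps)
  then show ?thesis by (simp only: mem_carrier)
qed

lemma carrier_mult:
  assumes "x \<in> carrier A" "y \<in> carrier A"
  shows "x * y \<in> carrier A"
proof -
  obtain a b where x: "x = of_int a + of_int b * w"
    using assms(1) by (rule carrierE)
  obtain a' b' where y: "y = of_int a' + of_int b' * w"
    using assms(2) by (rule carrierE)
  have "x * y = of_int a * of_int a' + (of_int a * of_int b' + of_int b * of_int a') * w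
      + of_int b * of_int b' * (w * w)"
    by (simp add: x y algebra_simps)
  also have "\<dots> = of_int (a * a' + m * b * b') + of_int (a * b' + b * a' + b * b') * w"
    unfolding w_squared by (simp add: algebra_simps)
  finally show ?thesis by (simp only: mem_carrier)
qed

lemma of_int_mem_carrier: "of_int a \<in> carrier A"
  using mem_carrier[of a 0] by simp

lemma w_mem_carrier: "w \<in> carrier A"
  using mem_carrier[of 0 1] by simp

lemma carrier_uminus: "- x \<in> carrier A" if "x \<in> carrier A"
  using carrier_mult[OF of_int_mem_carrier[of "-1"] that] by simp

text \<open>The additive inverse is a definite description over the carrier, so it is identified
  with \<open>- y\<close> by checking existence and uniqueness there.\<close>

lemma a_minus [simp]: "x \<ominus>\<^bsub>A\<^esub> y = x - y" if "y \<in> carrier A"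
proof -
  have "\<ominus>\<^bsub>A\<^esub> y = - y"
    unfolding a_inv_def m_inv_def
    by (rule the_equality) (use carrier_uminus[OF that] in \<open>auto simp: eq_neg_iff_add_eq_0 add.commute\<close>)
  then show ?thesis
    by (simp add: a_minus_def)
qed

text \<open>\<open>f\<close> fixes the integers, so \<open>f w\<close> satisfies the quadratic
  equation of \<open>w\<close>, whose roots are \<open>w\<close> and \<open>1 - w\<close>.\<close>

lemma ring_endomorphism_cases:
  assumes endo: "ring_endomorphism A f" and nonzero: "\<exists>x\<in>carrier A. f x \<noteq> 0"
  shows "(\<forall>a b. f (of_int a + of_int b * w) = of_int a + of_int b * w) \<or>
    (\<forall>a b. f (of_int a + of_int b * w) = of_int a + of_int b * (1 - w))"
proof -
  have add: "f (x + y) = f x + f y" and mult: "f (x * y) = f x * f y"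
    if "x \<in> carrier A" "y \<in> carrier A" for x y
    using endo that by (auto simp: ring_endomorphism_def)
  note int = of_int_mem_carrier
  obtain x where "x \<in> carrier A" "f x \<noteq> 0"
    using nonzero by blast
  \<comment> \<open>Cancel the nonzero \<open>f x\<close> in \<open>f x = f x * f 1\<close>.\<close>
  then have one: "f 1 = 1"
    using mult[of x 1] int[of 1] by simp
  have zero: "f 0 = 0"
    using add[of 0 0] int[of 0] by simp
  have f_int: "f (of_int k) = of_int k" for k
  proof (induction k rule: int_induct[of _ 0])
    case base
    show ?case by (simp add: zero)
  next
    case (step1 i)
    then show ?case using add[OF int[of i] int[of 1]] one by simp
  next
    case (step2 i)
    then show ?case using add[OF int[of "i - 1"] int[of 1]] one by (simp add: algebra_simps)
  qed
  have f: "f (of_int a + of_int b * w) = of_int a + of_int b * f w" for a b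
    using add[OF int carrier_mult[OF int w_mem_carrier]] mult[OF int w_mem_carrier]
    by (simp add: f_int)
  have "f w * f w = f w + of_int m"
    using mult[OF w_mem_carrier w_mem_carrier] add[OF w_mem_carrier int[of m]]
    by (simp add: w_squared f_int)
  then have "(f w - w) * (f w - (1 - w)) = 0"
    using w_squared by (simp add: algebra_simps)
  then have "f w = w \<or> f w = 1 - w"
    by simp
  then show ?thesis
    by (auto simp: f)
qed

text \<open>One of the two maps is the identity and the other is conjugation. The sign
  \<open>\<epsilon>\<close> is \<open>1\<close> if \<open>\<tau>\<close> is the identity and
  \<open>- 1\<close> if \<open>\<sigma>\<close> is.\<close>

lemma ring_endomorphism_diff:
  assumes "ring_endomorphism A \<sigma>" "\<exists>x\<in>carrier A. \<sigma> x \<noteq> 0"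
    and "ring_endomorphism A \<tau>" "\<exists>x\<in>carrier A. \<tau> x \<noteq> 0"
    and "\<exists>x\<in>carrier A. \<sigma> x \<noteq> \<tau> x"
  obtains \<epsilon> :: int where "\<epsilon> = 1 \<or> \<epsilon> = - 1"
    "\<And>a b. \<tau> (of_int a + of_int b * w) - \<sigma> (of_int a + of_int b * w) = of_int \<epsilon> * of_int b * s"
proof -
  obtain a b where neq: "\<sigma> (of_int a + of_int b * w) \<noteq> \<tau> (of_int a + of_int b * w)"
    using assms(5) by (metis carrierE)
  from ring_endomorphism_cases[OF assms(1,2)] ring_endomorphism_cases[OF assms(3,4)]
  show thesis
  proof (elim disjE)
    assume "\<forall>a b. \<sigma> (of_int a + of_int b * w) = of_int a + of_int b * w"
      "\<forall>a b. \<tau> (of_int a + of_int b * w) = of_int a + of_int b * (1 - w)"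
    then show thesis
      by (intro that[of "-1"]) (simp_all add: s_eq algebra_simps)
  next
    assume "\<forall>a b. \<sigma> (of_int a + of_int b * w) = of_int a + of_int b * (1 - w)"
      "\<forall>a b. \<tau> (of_int a + of_int b * w) = of_int a + of_int b * w"
    then show thesis
      by (intro that[of 1]) (simp_all add: s_eq algebra_simps)
  qed (use neq in auto)
qed

text \<open>Since \<open>s * s = d\<close>, an element is a multiple of \<open>s\<close> iff its
  product with \<open>s\<close> is a multiple of \<open>d\<close>. The two integers on the right are
  the coordinates of that product; the proof argues in coordinates throughout.\<close>

lemma s_multiple_iff:
  "(\<exists>\<beta>\<in>carrier A. of_int c0 + of_int c1 * w = \<beta> * s) \<longleftrightarrow>
     d dvd - c0 + c1 * ((d - 1) div 2) \<and> d dvd 2 * c0 + c1"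
proof -
  have half: "(d - 1) div 2 = 2 * m"
    using four_times_m(1) by presburger
  have d: "d = 4 * m + 1"
    using four_times_m(1) by simp
  have prod: "(of_int a + of_int b * w) * s = of_int (2 * m * b - a) + of_int (2 * a + b) * w" for a b
  proof -
    have "(of_int a + of_int b * w) * s = of_int a * (2 * w - 1) + of_int b * (2 * (w * w) - w)"
      by (simp add: s_eq algebra_simps)
    also have "\<dots> = of_int (2 * m * b - a) + of_int (2 * a + b) * w"
      unfolding w_squared by (simp add: algebra_simps)
    finally show ?thesis .
  qed
  have "(\<exists>\<beta>\<in>carrier A. of_int c0 + of_int c1 * w = \<beta> * s) \<longleftrightarrow>
      (\<exists>a b. of_int c0 + of_int c1 * w = (of_int a + of_int b * w) * s)"
    by (auto simp: carrier_quadratic_integers)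
  also have "\<dots> \<longleftrightarrow> (\<exists>a b. c0 = 2 * m * b - a \<and> c1 = 2 * a + b)"
    by (simp only: prod integer_combination_eq_iff)
  also have "\<dots> \<longleftrightarrow> (\<exists>a b. - c0 + c1 * (2 * m) = d * a \<and> 2 * c0 + c1 = d * b)"
    using integer_system_iff[OF d d_nonzero] by simp
  also have "\<dots> \<longleftrightarrow> d dvd - c0 + c1 * (2 * m) \<and> d dvd 2 * c0 + c1"
    by (auto simp: dvd_def)
  finally show ?thesis by (simp only: half)
qed

text \<open>Both endomorphisms fix 1, so the product rule gives \<open>D 1 = D 1 + D 1\<close> and
  \<open>D\<close> vanishes on the integers.\<close>

lemma twisted_derivation_integer_combination:
  assumes D: "twisted_derivation \<Z> A \<sigma> \<tau> D"
    and \<sigma>: "ring_endomorphism A \<sigma>" "\<exists>x\<in>carrier A. \<sigma> x \<noteq> 0"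
    and \<tau>: "ring_endomorphism A \<tau>" "\<exists>x\<in>carrier A. \<tau> x \<noteq> 0"
  shows "D (of_int a + of_int b * w) = of_int b * D w"
proof -
  note int = of_int_mem_carrier
  have add: "D (x + y) = D x + D y" and mult: "D (x * y) = D x * \<tau> y + \<sigma> x * D y"
    and smult: "D (of_int k * x) = of_int k * D x"
    if "x \<in> carrier A" "y \<in> carrier A" for x y k
    using D that by (auto simp: twisted_derivation_def)
  have one: "f 1 = 1" if "ring_endomorphism A f" "\<exists>x\<in>carrier A. f x \<noteq> 0" for f
    using ring_endomorphism_cases[OF that] by (metis add.right_neutral mult_zero_left of_int_0 of_int_1)
  have "D 1 = D 1 * \<tau> 1 + \<sigma> 1 * D 1"
    using mult[OF int[of 1] int[of 1]] by simp
  also have "\<dots> = D 1 + D 1"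
    by (simp only: one[OF \<sigma>] one[OF \<tau>] mult_1 mult_1_right)
  finally have "D 1 = D 1 + D 1" .
  then have "D 1 = 0"
    by simp
  have "D (of_int a + of_int b * w) = D (of_int a * 1) + D (of_int b * w)"
    using add[OF int[of a] carrier_mult[OF int[of b] w_mem_carrier]] by simp
  also have "\<dots> = of_int a * D 1 + of_int b * D w"
    using smult[of 1 1] smult[of w w] int[of 1] w_mem_carrier by simp
  finally show ?thesis
    using \<open>D 1 = 0\<close> by simp
qed

text \<open>By commutativity the inner derivation of \<open>\<beta>\<close> is
  \<open>\<beta> * (\<tau> x - \<sigma> x)\<close>. Like \<open>D\<close>, it is determined by its
  value at \<open>w\<close>, here a sign times \<open>\<beta> * s\<close>, so the question is
  whether \<open>s\<close> divides \<open>D w\<close>.\<close>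

lemma is_inner_iff:
  assumes D: "twisted_derivation \<Z> A \<sigma> \<tau> D"
    and endo: "ring_endomorphism A \<sigma>" "\<exists>x\<in>carrier A. \<sigma> x \<noteq> 0"
      "ring_endomorphism A \<tau>" "\<exists>x\<in>carrier A. \<tau> x \<noteq> 0"
      "\<exists>x\<in>carrier A. \<sigma> x \<noteq> \<tau> x"
    and Dw: "D w = of_int c0 + of_int c1 * w"
  shows "is_inner A \<sigma> \<tau> D \<longleftrightarrow> d dvd - c0 + c1 * ((d - 1) div 2) \<and> d dvd 2 * c0 + c1"
proof -
  obtain \<epsilon> :: int where \<epsilon>: "\<epsilon> = 1 \<or> \<epsilon> = - 1"
    "\<And>a b. \<tau> (of_int a + of_int b * w) - \<sigma> (of_int a + of_int b * w) = of_int \<epsilon> * of_int b * s"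
    using ring_endomorphism_diff[OF endo] by blast
  note D_eq = twisted_derivation_integer_combination[OF D endo(1-4)]
  have \<sigma>_closed: "\<sigma> x \<in> carrier A" if "x \<in> carrier A" for x
    using endo(1) that by (auto simp: ring_endomorphism_def)
  have inner_value: "\<beta> \<otimes>\<^bsub>A\<^esub> \<tau> x \<ominus>\<^bsub>A\<^esub> (\<sigma> x \<otimes>\<^bsub>A\<^esub> \<beta>) = of_int b * (of_int \<epsilon> * \<beta> * s)"
    if "\<beta> \<in> carrier A" "x = of_int a + of_int b * w" for \<beta> x a b
  proof -
    have "\<sigma> x * \<beta> \<in> carrier A"
      using that \<sigma>_closed mem_carrier carrier_mult by blast
    then have "\<beta> \<otimes>\<^bsub>A\<^esub> \<tau> x \<ominus>\<^bsub>A\<^esub> (\<sigma> x \<otimes>\<^bsub>A\<^esub> \<beta>) = \<beta> * (\<tau> x - \<sigma> x)"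
      by (simp add: algebra_simps)
    also have "\<dots> = of_int b * (of_int \<epsilon> * \<beta> * s)"
      unfolding that(2) \<epsilon>(2) by (simp add: algebra_simps)
    finally show ?thesis .
  qed
  have "is_inner A \<sigma> \<tau> D \<longleftrightarrow> (\<exists>\<beta>\<in>carrier A. D w = of_int \<epsilon> * \<beta> * s)"
    unfolding is_inner_def
  proof (intro bex_cong refl iffI ballI)
    fix \<beta>
    assume "\<beta> \<in> carrier A"
      "\<forall>x\<in>carrier A. D x = \<beta> \<otimes>\<^bsub>A\<^esub> \<tau> x \<ominus>\<^bsub>A\<^esub> (\<sigma> x \<otimes>\<^bsub>A\<^esub> \<beta>)"
    then show "D w = of_int \<epsilon> * \<beta> * s"
      using w_mem_carrier inner_value[of \<beta> w 0 1] by simp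
  next
    fix \<beta> x
    assume *: "\<beta> \<in> carrier A" "D w = of_int \<epsilon> * \<beta> * s" "x \<in> carrier A"
    from *(3) obtain a b where x: "x = of_int a + of_int b * w"
      by (rule carrierE)
    show "D x = \<beta> \<otimes>\<^bsub>A\<^esub> \<tau> x \<ominus>\<^bsub>A\<^esub> (\<sigma> x \<otimes>\<^bsub>A\<^esub> \<beta>)"
      unfolding inner_value[OF *(1) x] using D_eq[of a b] *(2) x by simp
  qed
  \<comment> \<open>The sign \<open>\<epsilon>\<close> is absorbed into
    \<open>\<beta>\<close>.\<close>
  also have "\<dots> \<longleftrightarrow> (\<exists>\<beta>\<in>carrier A. D w = \<beta> * s)"
  proof
    assume "\<exists>\<beta>\<in>carrier A. D w = of_int \<epsilon> * \<beta> * s"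
    then show "\<exists>\<beta>\<in>carrier A. D w = \<beta> * s"
      using carrier_mult of_int_mem_carrier by blast
  next
    assume "\<exists>\<beta>\<in>carrier A. D w = \<beta> * s"
    then obtain \<beta> where "\<beta> \<in> carrier A" "D w = \<beta> * s" by blast
    moreover have "of_int \<epsilon> * of_int \<epsilon> = (1 :: complex)"
      using \<epsilon>(1) by auto
    ultimately have "of_int \<epsilon> * \<beta> \<in> carrier A" "D w = of_int \<epsilon> * (of_int \<epsilon> * \<beta>) * s"
      using carrier_mult of_int_mem_carrier by (simp_all flip: mult.assoc)
    then show "\<exists>\<beta>\<in>carrier A. D w = of_int \<epsilon> * \<beta> * s" by blast
  qed
  finally show ?thesis
    by (simp only: Dw s_multiple_iff)
qed

text \<open>The difference quotient by \<open>s\<close> has the inner form with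
  \<open>\<beta> = 1 / s\<close>, which lies in the field but not in the ring of integers.\<close>

lemma exists_non_inner_derivation:
  assumes endo: "ring_endomorphism A \<sigma>" "\<exists>x\<in>carrier A. \<sigma> x \<noteq> 0"
      "ring_endomorphism A \<tau>" "\<exists>x\<in>carrier A. \<tau> x \<noteq> 0"
      "\<exists>x\<in>carrier A. \<sigma> x \<noteq> \<tau> x"
  obtains D where "D \<in> extensional (carrier A)" "twisted_derivation \<Z> A \<sigma> \<tau> D" "\<not> is_inner A \<sigma> \<tau> D"
proof -
  define D where "D = (\<lambda>x\<in>carrier A. (\<tau> x - \<sigma> x) / s)"
  obtain \<epsilon> :: int where \<epsilon>: "\<epsilon> = 1 \<or> \<epsilon> = - 1"
    "\<And>a b. \<tau> (of_int a + of_int b * w) - \<sigma> (of_int a + of_int b * w) = of_int \<epsilon> * of_int b * s"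
    using ring_endomorphism_diff[OF endo] by blast
  have D_eq: "D (of_int a + of_int b * w) = of_int (\<epsilon> * b)" for a b
    using mem_carrier s_nonzero by (simp add: D_def \<epsilon>(2))
  have hom: "f (x + y) = f x + f y" "f (x * y) = f x * f y"
    if "f = \<sigma> \<or> f = \<tau>" "x \<in> carrier A" "y \<in> carrier A" for f x y
    using endo(1,3) that by (auto simp: ring_endomorphism_def)
  have "twisted_derivation \<Z> A \<sigma> \<tau> D"
    unfolding twisted_derivation_def operations
  proof (intro conjI ballI funcsetI)
    fix x assume "x \<in> carrier A"
    then show "D x \<in> carrier A"
      by (rule carrierE) (simp only: D_eq of_int_mem_carrier)
  next
    fix x y assume xy: "x \<in> carrier A" "y \<in> carrier A"
    then show "D (x + y) = D x + D y"
      by (simp add: D_def carrier_add hom add_divide_distrib diff_divide_distrib)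
    \<comment> \<open>The twisted product rule comes from adding and subtracting
      \<open>\<sigma> x * \<tau> y\<close>.\<close>
    have "D (x * y) = ((\<tau> x - \<sigma> x) * \<tau> y + \<sigma> x * (\<tau> y - \<sigma> y)) / s"
      using xy by (simp add: D_def carrier_mult hom algebra_simps)
    then show "D (x * y) = D x * \<tau> y + \<sigma> x * D y"
      using xy by (simp add: D_def add_divide_distrib)
  next
    fix k x assume "x \<in> carrier A"
    then obtain a b where x: "x = of_int a + of_int b * w"
      by (rule carrierE)
    then have "of_int k * x = of_int (k * a) + of_int (k * b) * w"
      by (simp add: algebra_simps)
    then show "D (of_int k * x) = of_int k * D x"
      by (simp only: x D_eq) simp
  qed
  moreover have "\<not> is_inner A \<sigma> \<tau> D"
    \<comment> \<open>With \<open>c0 = \<epsilon>\<close> and \<open>c1 = 0\<close> the criterion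
      would make \<open>d\<close> a divisor of a unit.\<close>
    using is_inner_iff[OF \<open>twisted_derivation \<Z> A \<sigma> \<tau> D\<close> endo, of \<epsilon> 0] D_eq[of 0 1] \<epsilon>(1) d_not_unit
    by auto
  moreover have "D \<in> extensional (carrier A)"
    by (simp add: D_def)
  ultimately show thesis
    by (rule that[rotated])
qed

text \<open>In a trivial quotient the inner derivations are the only coset. They contain the zero
  map, given by \<open>\<beta> = 0\<close>, so every derivation would be inner, against the previous
  lemma.\<close>

lemma outer_derivations_nontrivial:
  assumes endo: "ring_endomorphism A \<sigma>" "\<exists>x\<in>carrier A. \<sigma> x \<noteq> 0"
      "ring_endomorphism A \<tau>" "\<exists>x\<in>carrier A. \<tau> x \<noteq> 0"
      "\<exists>x\<in>carrier A. \<sigma> x \<noteq> \<tau> x"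
  shows "carrier (outer_derivations \<Z> A \<sigma> \<tau>) \<noteq> {\<zero>\<^bsub>outer_derivations \<Z> A \<sigma> \<tau>\<^esub>}"
proof
  assume *: "carrier (outer_derivations \<Z> A \<sigma> \<tau>) = {\<zero>\<^bsub>outer_derivations \<Z> A \<sigma> \<tau>\<^esub>}"
  let ?M = "derivation_module \<Z> A \<sigma> \<tau>" and ?N = "inner_derivations \<Z> A \<sigma> \<tau>"
  let ?zero = "\<lambda>x\<in>carrier A. 0 :: complex"
  obtain D where D: "D \<in> extensional (carrier A)" "twisted_derivation \<Z> A \<sigma> \<tau> D"
    "\<not> is_inner A \<sigma> \<tau> D"
    using exists_non_inner_derivation[OF endo] .
  have "twisted_derivation \<Z> A \<sigma> \<tau> ?zero"
    using of_int_mem_carrier[of 0] of_int_mem_carrier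
    by (auto simp: twisted_derivation_def carrier_add carrier_mult)
  moreover have "is_inner A \<sigma> \<tau> ?zero"
    using of_int_mem_carrier[of 0] unfolding is_inner_def by (intro bexI[of _ 0]) auto
  ultimately have "?zero \<in> ?N"
    by (simp add: inner_derivations_def derivation_module_def)
  moreover have "a_rcosets\<^bsub>?M\<^esub> ?N = {?N}"
    using * by (simp add: outer_derivations_def quotient_module_def)
  moreover have "D \<in> carrier ?M"
    using D by (simp add: derivation_module_def)
  moreover have "?zero \<oplus>\<^bsub>?M\<^esub> D = D"
    using D(1) by (auto simp: derivation_module_def extensional_def)
  ultimately have "D \<in> ?N"
    by (metis a_rcosets_trivial_imp_mem)
  then show False
    using D(3) by (simp add: inner_derivations_def)
qed

end

theorem theorem3p5:
  fixes d :: int and \<sigma> \<tau> :: "complex \<Rightarrow> complex"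
  assumes "squarefree d" and "[d = 1] (mod 4)" and "d \<noteq> 1"
    and "ring_endomorphism (quadratic_integers d) \<sigma>"
    and "\<exists>x\<in>carrier (quadratic_integers d). \<sigma> x \<noteq> 0"
    and "ring_endomorphism (quadratic_integers d) \<tau>"
    and "\<exists>x\<in>carrier (quadratic_integers d). \<tau> x \<noteq> 0"
    and "\<exists>x\<in>carrier (quadratic_integers d). \<sigma> x \<noteq> \<tau> x"
  shows "(\<forall>D. \<forall>c0 c1 :: int.
            twisted_derivation \<Z> (quadratic_integers d) \<sigma> \<tau> D \<and>
            D ((1 + csqrt (of_int d)) / 2) = of_int c0 + of_int c1 * ((1 + csqrt (of_int d)) / 2) \<longrightarrow>
              (is_inner (quadratic_integers d) \<sigma> \<tau> D \<longleftrightarrow>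
                 d dvd - c0 + c1 * ((d - 1) div 2) \<and> d dvd 2 * c0 + c1) \<and>
              (d dvd c0 \<and> d dvd c1 \<longrightarrow> is_inner (quadratic_integers d) \<sigma> \<tau> D)) \<and>
         carrier (outer_derivations \<Z> (quadratic_integers d) \<sigma> \<tau>)
           \<noteq> {\<zero>\<^bsub>outer_derivations \<Z> (quadratic_integers d) \<sigma> \<tau>\<^esub>}"
proof -
  interpret quadratic_1_mod_4 d
    by unfold_locales (fact assms)+
  have inner: "is_inner A \<sigma> \<tau> D \<longleftrightarrow> d dvd - c0 + c1 * ((d - 1) div 2) \<and> d dvd 2 * c0 + c1"
    if "twisted_derivation \<Z> A \<sigma> \<tau> D"
      "D ((1 + csqrt (of_int d)) / 2) = of_int c0 + of_int c1 * ((1 + csqrt (of_int d)) / 2)"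
    for D c0 c1
    using is_inner_iff[OF that(1) assms(4-8), folded w_def s_def] that(2)
    by (simp add: w_def s_def)
  show ?thesis
  proof (intro conjI allI impI; (elim conjE)?)
    show "carrier (outer_derivations \<Z> A \<sigma> \<tau>) \<noteq> {\<zero>\<^bsub>outer_derivations \<Z> A \<sigma> \<tau>\<^esub>}"
      using assms(4-8) by (rule outer_derivations_nontrivial)
  \<comment> \<open>Claim (i) follows because both expressions in the criterion are integer
    combinations of \<open>c0\<close> and \<open>c1\<close>.\<close>
  qed (simp_all add: inner)
qed

end
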